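(* Let $\vec{b}$ and $\vec{b}'$ be braid systems (possibly of different degrees and lengths). If $\vec{b}$ and $\vec{b}'$ are related by a finite sequence of transformations each of which is a Hurwitz action, a global conjugation, a stabilization, or a destabilization, then $E(\vec{b})=E(\vec{b}')$, where $E$ denotes the essential eigenvalue set.
   Context: $B_m$ is the $m$-strand braid group with standard generators $\sigma_1,\dots,\sigma_{m-1}$ and relations $\sigma_i\sigma_j\sigma_i=\sigma_j\sigma_i\sigma_j$ for $|i-j|=1$, $\sigma_i\sigma_j=\sigma_j\sigma_i$ for $|i-j|>1$ ($B_1$ is trivial). Braids are read from top to bottom, $bc$ meaning $b$ placed above $c$. The $k$-th strand of a braid (diagram) is the strand whose upper endpoint is at the $k$-th position from the left. The letter $\sigma_i$ is a positive crossing between the strands currently at positions $i$ and $i+1$, at which the strand at position $i$ passes over; $\sigma_i^{-1}$ is a negative crossing between the strands currently at positions $i$ and $i+1$, at which the strand at position $i+1$ passes over. The crossing matrix $C(b)$ of $b\in B_m$ is the $m\times m$ integer matrix with zero diagonal whose $(i,j)$-entry ($i\neq j$) is, for any diagram (word) of $b$, the number of positive crossings minus the number of negative crossings between the $i$-th and $j$-th strands at which the $i$-th strand passes over the $j$-th strand; it does not depend on the diagram. The braid permutation of $b$ is the permutation of $\{1,\dots,m\}$ sending $k$ to the bottom position of the $k$-th strand. A braid system of degree $m$ and length $n$ is an element $\vec{b}=(b_1,\dots,b_n)\in (B_m)^n$. Let $r_i$ be the order of the braid permutation of $b_i$. The essential eigenvalue set $E(\vec{b})$ is the multiset of all eigenvalues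 (with algebraic multiplicity) of $C(b_1^{r_1}),\dots,C(b_n^{r_n})$, with all occurrences of $0,1,-1$ removed. For braids $g,h$ put $g*h=h^{-1}gh$. Hurwitz action: the right action of $B_n$ on $(B_m)^n$ given by $(g_1,\dots,g_n)\cdot\sigma_i=(g_1,\dots,g_{i-1},g_{i+1},g_i*g_{i+1},g_{i+2},\dots,g_n)$ and $(g_1,\dots,g_n)\cdot\sigma_i^{-1}=(g_1,\dots,g_{i-1},g_{i+1}*(g_i^{-1}),g_i,g_{i+2},\dots,g_n)$ for $1\le i\le n-1$. Global conjugation by $a\in B_m$: $(b_1,\dots,b_n)\mapsto(b_1*a,\dots,b_n*a)$. Stabilization: $(b_1,\dots,b_n)\in(B_m)^n\mapsto(\iota(b_1),\dots,\iota(b_n),\sigma_m,\sigma_m^{-1})\in(B_{m+1})^{n+2}$, where $\iota:B_m\to B_{m+1}$ is the homomorphism with $\iota(\sigma_i)=\sigma_i$ (adding a trivial $(m+1)$-th strand on the right). Destabilization is the inverse of a stabilization, when it exists. *)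

theory Defs
  imports "HOL-Algebra.Sym_Groups" "HOL-Algebra.Multiplicative_Group"
    "Jordan_Normal_Form.Char_Poly"
begin

section \<open>Braid words and the braid groups\<close>

text \<open>\<open>Sig i\<close> and \<open>SigInv i\<close> stand for \<open>\<sigma>\<^sub>i\<close> and its inverse; positions and generators are
  counted from 1. A word is read from left to right, that is, from the top of the diagram to
  the bottom.\<close>

datatype braid_letter = Sig nat | SigInv nat

definition braid_words :: "nat \<Rightarrow> braid_letter list set" where
  "braid_words m = lists (Sig ` {1..<m} \<union> SigInv ` {1..<m})"

inductive braid_eq :: "nat \<Rightarrow> braid_letter list \<Rightarrow> braid_letter list \<Rightarrow> bool" for m where
  refl: "w \<in> braid_words m \<Longrightarrow> braid_eq m w w"
| sym: "braid_eq m u v \<Longrightarrow> braid_eq m v u"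
| trans: "braid_eq m u v \<Longrightarrow> braid_eq m v w \<Longrightarrow> braid_eq m u w"
| congruence: "braid_eq m u v \<Longrightarrow> a \<in> braid_words m \<Longrightarrow> c \<in> braid_words m
    \<Longrightarrow> braid_eq m (a @ u @ c) (a @ v @ c)"
| cancel_right: "i \<in> {1..<m} \<Longrightarrow> braid_eq m [Sig i, SigInv i] []"
| cancel_left: "i \<in> {1..<m} \<Longrightarrow> braid_eq m [SigInv i, Sig i] []"
| braid: "i \<in> {1..<m} \<Longrightarrow> Suc i \<in> {1..<m}
    \<Longrightarrow> braid_eq m [Sig i, Sig (Suc i), Sig i] [Sig (Suc i), Sig i, Sig (Suc i)]"
| commute: "i \<in> {1..<m} \<Longrightarrow> j \<in> {1..<m} \<Longrightarrow> Suc i < j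
    \<Longrightarrow> braid_eq m [Sig i, Sig j] [Sig j, Sig i]"

definition braid_rel :: "nat \<Rightarrow> (braid_letter list \<times> braid_letter list) set" where
  "braid_rel m = {(u, v). braid_eq m u v}"

type_synonym braid = "braid_letter list set"

definition braid_class :: "nat \<Rightarrow> braid_letter list \<Rightarrow> braid" where
  "braid_class m w = braid_rel m `` {w}"

text \<open>If \<open>f\<close> takes the same value on all words representing the braid \<open>b\<close>, this is that
  value.\<close>

definition lift_braid :: "(braid_letter list \<Rightarrow> 'a) \<Rightarrow> braid \<Rightarrow> 'a" where
  "lift_braid f b = the_elem (f ` b)"

definition braid_group :: "nat \<Rightarrow> braid monoid" where
  "braid_group m =
    \<lparr>carrier = braid_words m // braid_rel m,
     mult = (\<lambda>b c. lift_braid (\<lambda>u. lift_braid (\<lambda>v. braid_class m (u @ v)) c) b),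
     one = braid_class m []\<rparr>"

definition sigma :: "nat \<Rightarrow> nat \<Rightarrow> braid" where
  "sigma m i = braid_class m [Sig i]"

definition add_strand :: "nat \<Rightarrow> braid \<Rightarrow> braid" where
  "add_strand m = lift_braid (braid_class (Suc m))"

section \<open>Braid permutation and crossing matrix\<close>

text \<open>\<open>word_perm w k\<close> is the bottom position of the strand whose upper endpoint is at
  position \<open>k\<close>. After a first letter with index \<open>i\<close>, this strand is at position
  \<open>transpose i (Suc i) k\<close>, and the remaining word is a diagram starting from there; the same
  decomposition is used to count crossings.\<close>

fun letter_index :: "braid_letter \<Rightarrow> nat" where
  "letter_index (Sig i) = i"
| "letter_index (SigInv i) = i"

abbreviation letter_perm :: "braid_letter \<Rightarrow> nat \<Rightarrow> nat" where
  "letter_perm l \<equiv> transpose (letter_index l) (Suc (letter_index l))"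

fun word_perm :: "braid_letter list \<Rightarrow> nat \<Rightarrow> nat" where
  "word_perm [] = id"
| "word_perm (l # w) = word_perm w \<circ> letter_perm l"

text \<open>The signed contribution of a single crossing between the strands at positions \<open>i\<close> and
  \<open>j\<close> at which the strand at position \<open>i\<close> passes over.\<close>

fun letter_over :: "braid_letter \<Rightarrow> nat \<Rightarrow> nat \<Rightarrow> int" where
  "letter_over (Sig k) i j = (if i = k \<and> j = Suc k then 1 else 0)"
| "letter_over (SigInv k) i j = (if i = Suc k \<and> j = k then - 1 else 0)"

fun word_over :: "braid_letter list \<Rightarrow> nat \<Rightarrow> nat \<Rightarrow> int" where
  "word_over [] i j = 0"
| "word_over (l # w) i j = letter_over l i j + word_over w (letter_perm l i) (letter_perm l j)"

text \<open>Matrix indices start at 0, strand numbers at 1.\<close>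

definition word_crossing_matrix :: "nat \<Rightarrow> braid_letter list \<Rightarrow> int mat" where
  "word_crossing_matrix m w =
    mat m m (\<lambda>(i, j). if i = j then 0 else word_over w (Suc i) (Suc j))"

definition braid_perm :: "braid \<Rightarrow> nat \<Rightarrow> nat" where
  "braid_perm = lift_braid word_perm"

definition crossing_matrix :: "nat \<Rightarrow> braid \<Rightarrow> int mat" where
  "crossing_matrix m = lift_braid (word_crossing_matrix m)"

section \<open>Braid systems and the essential eigenvalue set\<close>

text \<open>A braid system is a pair of its degree and the list of its entries.\<close>

type_synonym braid_system = "nat \<times> braid list"

definition is_braid_system :: "braid_system \<Rightarrow> bool" where
  "is_braid_system = (\<lambda>(m, bs). 1 \<le> m \<and> set bs \<subseteq> carrier (braid_group m))"

definition perm_order :: "nat \<Rightarrow> braid \<Rightarrow> nat" where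
  "perm_order m b = group.ord (sym_group m) (braid_perm b)"

definition eigenvalues_mset :: "int mat \<Rightarrow> complex multiset" where
  "eigenvalues_mset A = proots (char_poly (map_mat complex_of_int A))"

definition essential_eigenvalues :: "braid_system \<Rightarrow> complex multiset" where
  "essential_eigenvalues = (\<lambda>(m, bs).
    filter_mset (\<lambda>x. x \<notin> {0, 1, - 1})
      (\<Sum>b\<leftarrow>bs. eigenvalues_mset
        (crossing_matrix m (b [^]\<^bsub>braid_group m\<^esub> perm_order m b))))"

section \<open>Transformations of braid systems\<close>

definition conj_by :: "('a, 'b) monoid_scheme \<Rightarrow> 'a \<Rightarrow> 'a \<Rightarrow> 'a" where
  "conj_by G g h = inv\<^bsub>G\<^esub> h \<otimes>\<^bsub>G\<^esub> g \<otimes>\<^bsub>G\<^esub> h"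

text \<open>The list entry \<open>gs ! i\<close> is the component \<open>g\<close> with index \<open>i + 1\<close>.\<close>

fun hurwitz_letter :: "('a, 'b) monoid_scheme \<Rightarrow> 'a list \<Rightarrow> braid_letter \<Rightarrow> 'a list" where
  "hurwitz_letter G gs (Sig i) =
    gs[i - 1 := gs ! i, i := conj_by G (gs ! (i - 1)) (gs ! i)]"
| "hurwitz_letter G gs (SigInv i) =
    gs[i - 1 := conj_by G (gs ! i) (inv\<^bsub>G\<^esub> (gs ! (i - 1))), i := gs ! (i - 1)]"

definition hurwitz_act :: "('a, 'b) monoid_scheme \<Rightarrow> 'a list \<Rightarrow> braid \<Rightarrow> 'a list" where
  "hurwitz_act G gs = lift_braid (foldl (hurwitz_letter G) gs)"

definition stabilize :: "braid_system \<Rightarrow> braid_system" where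
  "stabilize = (\<lambda>(m, bs).
    (Suc m, map (add_strand m) bs @
      [sigma (Suc m) m, inv\<^bsub>braid_group (Suc m)\<^esub> (sigma (Suc m) m)]))"

inductive braid_move :: "braid_system \<Rightarrow> braid_system \<Rightarrow> bool" where
  hurwitz: "is_braid_system (m, bs) \<Longrightarrow> \<beta> \<in> carrier (braid_group (length bs))
    \<Longrightarrow> braid_move (m, bs) (m, hurwitz_act (braid_group m) bs \<beta>)"
| conjugation: "is_braid_system (m, bs) \<Longrightarrow> a \<in> carrier (braid_group m)
    \<Longrightarrow> braid_move (m, bs) (m, map (\<lambda>b. conj_by (braid_group m) b a) bs)"
| stabilization: "is_braid_system S \<Longrightarrow> braid_move S (stabilize S)"
| destabilization: "is_braid_system S \<Longrightarrow> braid_move (stabilize S) S"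

section \<open>Independence of the representing word\<close>

lemma braid_words_Nil [simp]: "[] \<in> braid_words m"
  by (simp add: braid_words_def)

lemma braid_words_append [simp]:
  "u @ v \<in> braid_words m \<longleftrightarrow> u \<in> braid_words m \<and> v \<in> braid_words m"
  by (auto simp: braid_words_def)

lemma braid_words_Cons [simp]:
  "l # w \<in> braid_words m \<longleftrightarrow> letter_index l \<in> {1..<m} \<and> w \<in> braid_words m"
  by (cases l) (auto simp: braid_words_def)

lemma braid_eq_words: "braid_eq m u v \<Longrightarrow> u \<in> braid_words m \<and> v \<in> braid_words m"
  by (induction rule: braid_eq.induct) auto

lemma equiv_braid_rel: "equiv (braid_words m) (braid_rel m)"
proof (rule equivI)
  show "braid_rel m \<subseteq> braid_words m \<times> braid_words m"
    by (auto simp: braid_rel_def dest: braid_eq_words)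
  show "refl_on (braid_words m) (braid_rel m)"
    by (auto simp: refl_on_def braid_rel_def intro: braid_eq.refl)
  show "sym (braid_rel m)"
    by (auto simp: sym_def braid_rel_def intro: braid_eq.sym)
  show "trans (braid_rel m)"
    by (auto simp: trans_def braid_rel_def intro: braid_eq.trans)
qed

lemma braid_class_eq_iff:
  "u \<in> braid_words m \<Longrightarrow> v \<in> braid_words m
    \<Longrightarrow> braid_class m u = braid_class m v \<longleftrightarrow> braid_eq m u v"
  unfolding braid_class_def
  by (subst eq_equiv_class_iff[OF equiv_braid_rel]) (auto simp: braid_rel_def)

lemma braid_class_eqI: "braid_eq m u v \<Longrightarrow> braid_class m u = braid_class m v"
  using braid_class_eq_iff braid_eq_words by blast

lemma mem_braid_class: "v \<in> braid_class m w \<longleftrightarrow> braid_eq m w v"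
  by (simp add: braid_class_def braid_rel_def)

lemma braid_carrier: "carrier (braid_group m) = braid_class m ` braid_words m"
  by (auto simp: braid_group_def braid_class_def quotient_def)

lemma lift_braid_class:
  assumes "w \<in> braid_words m" and "\<And>v. braid_eq m w v \<Longrightarrow> f v = f w"
  shows "lift_braid f (braid_class m w) = f w"
proof -
  have "w \<in> braid_class m w"
    using assms(1) by (simp add: mem_braid_class braid_eq.refl)
  moreover have "f v = f w" if "v \<in> braid_class m w" for v
    using that assms(2) unfolding mem_braid_class by blast
  ultimately have "f ` braid_class m w = {f w}"
    by blast
  then show ?thesis by (simp add: lift_braid_def)
qed

lemma braid_eq_append:
  assumes "braid_eq m u u'" "braid_eq m v v'"
  shows "braid_eq m (u @ v) (u' @ v')"
proof -
  have words: "u' \<in> braid_words m" "v \<in> braid_words m"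
    using assms by (auto dest: braid_eq_words)
  have "braid_eq m ([] @ u @ v) ([] @ u' @ v)"
    by (rule braid_eq.congruence) (use assms words in auto)
  moreover have "braid_eq m (u' @ v @ []) (u' @ v' @ [])"
    by (rule braid_eq.congruence) (use assms words in auto)
  ultimately show ?thesis
    unfolding append_Nil append_Nil2 by (rule braid_eq.trans)
qed

lemma braid_mult:
  assumes "u \<in> braid_words m" "v \<in> braid_words m"
  shows "braid_class m u \<otimes>\<^bsub>braid_group m\<^esub> braid_class m v = braid_class m (u @ v)"
proof -
  have inner: "lift_braid (\<lambda>v. braid_class m (x @ v)) (braid_class m v) = braid_class m (x @ v)"
    if "x \<in> braid_words m" for x
  proof (rule lift_braid_class)
    fix y assume "braid_eq m v y"
    then show "braid_class m (x @ y) = braid_class m (x @ v)"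
      by (intro braid_class_eqI[OF braid_eq_append] braid_eq.refl that) (rule braid_eq.sym)
  qed (rule assms)
  have "lift_braid (\<lambda>u. lift_braid (\<lambda>v. braid_class m (u @ v)) (braid_class m v))
      (braid_class m u) = lift_braid (\<lambda>v. braid_class m (u @ v)) (braid_class m v)"
  proof (rule lift_braid_class)
    fix x assume *: "braid_eq m u x"
    then have "braid_class m (x @ v) = braid_class m (u @ v)"
      by (intro braid_class_eqI[OF braid_eq_append] braid_eq.refl assms) (rule braid_eq.sym)
    with * show "lift_braid (\<lambda>v. braid_class m (x @ v)) (braid_class m v) =
       lift_braid (\<lambda>v. braid_class m (u @ v)) (braid_class m v)"
      using assms(1) inner braid_eq_words by metis
  qed (use assms in auto)
  with inner[OF assms(1)] show ?thesis by (simp add: braid_group_def)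
qed

lemma braid_one: "\<one>\<^bsub>braid_group m\<^esub> = braid_class m []"
  by (simp add: braid_group_def)

fun letter_inv :: "braid_letter \<Rightarrow> braid_letter" where
  "letter_inv (Sig i) = SigInv i"
| "letter_inv (SigInv i) = Sig i"

lemma letter_index_inv [simp]: "letter_index (letter_inv l) = letter_index l"
  by (cases l) auto

lemma word_left_inverse:
  "w \<in> braid_words m \<Longrightarrow>
    \<exists>v \<in> braid_words m. braid_eq m (v @ w) []"
proof (induction w)
  case Nil
  then show ?case by (intro bexI[of _ "[]"]) (auto intro: braid_eq.refl)
next
  case (Cons l w)
  then obtain v where v: "v \<in> braid_words m" "braid_eq m (v @ w) []" by auto
  have "braid_eq m [letter_inv l, l] []"
    using Cons.prems by (cases l) (auto intro: braid_eq.intros)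
  then have "braid_eq m (v @ [letter_inv l, l] @ w) (v @ [] @ w)"
    by (rule braid_eq.congruence) (use v Cons.prems in auto)
  then have "braid_eq m ((v @ [letter_inv l]) @ l # w) (v @ w)"
    by simp
  from this v(2) have "braid_eq m ((v @ [letter_inv l]) @ l # w) []"
    by (rule braid_eq.trans)
  then show ?case using v Cons.prems by (intro bexI[of _ "v @ [letter_inv l]"]) auto
qed

lemma braid_class_closed: "w \<in> braid_words m \<Longrightarrow> braid_class m w \<in> carrier (braid_group m)"
  unfolding braid_carrier by (rule imageI)

lemma braid_cases:
  assumes "x \<in> carrier (braid_group m)"
  obtains w where "w \<in> braid_words m" "x = braid_class m w"
  using assms unfolding braid_carrier by (rule imageE)

lemma group_braid_group: "group (braid_group m)" (is "group ?B")
proof (rule groupI)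
  fix x y assume "x \<in> carrier ?B" "y \<in> carrier ?B"
  then obtain u v where "u \<in> braid_words m" "x = braid_class m u"
    "v \<in> braid_words m" "y = braid_class m v"
    by (metis braid_cases)
  then show "x \<otimes>\<^bsub>?B\<^esub> y \<in> carrier ?B"
    by (simp add: braid_mult braid_class_closed)
next
  show "\<one>\<^bsub>?B\<^esub> \<in> carrier ?B"
    by (simp add: braid_one braid_class_closed)
next
  fix x y z assume "x \<in> carrier ?B" "y \<in> carrier ?B" "z \<in> carrier ?B"
  then obtain u v w where "u \<in> braid_words m" "x = braid_class m u"
    "v \<in> braid_words m" "y = braid_class m v" "w \<in> braid_words m" "z = braid_class m w"
    by (metis braid_cases)
  then show "x \<otimes>\<^bsub>?B\<^esub> y \<otimes>\<^bsub>?B\<^esub> z = x \<otimes>\<^bsub>?B\<^esub> (y \<otimes>\<^bsub>?B\<^esub> z)"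
    by (simp add: braid_mult)
next
  fix x assume "x \<in> carrier ?B"
  then obtain w where w: "w \<in> braid_words m" "x = braid_class m w"
    by (rule braid_cases)
  then show "\<one>\<^bsub>?B\<^esub> \<otimes>\<^bsub>?B\<^esub> x = x"
    by (simp add: braid_mult braid_one)
  from word_left_inverse[OF w(1)] obtain v where
    v: "v \<in> braid_words m" "braid_eq m (v @ w) []" by (rule bexE)
  show "\<exists>y\<in>carrier ?B. y \<otimes>\<^bsub>?B\<^esub> x = \<one>\<^bsub>?B\<^esub>"
  proof (rule bexI)
    show "braid_class m v \<otimes>\<^bsub>?B\<^esub> x = \<one>\<^bsub>?B\<^esub>"
      using braid_class_eqI[OF v(2)] v(1) w by (simp add: braid_mult braid_one)
  qed (rule braid_class_closed[OF v(1)])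
qed

lemma add_strand_class:
  assumes "w \<in> braid_words m"
  shows "add_strand m (braid_class m w) = braid_class (Suc m) w"
proof -
  have words: "u \<in> braid_words m \<Longrightarrow> u \<in> braid_words (Suc m)" for u
    by (induction u) auto
  have "braid_eq (Suc m) u v" if "braid_eq m u v" for u v
    using that
  proof (induction rule: braid_eq.induct)
    case (sym u v)
    show ?case by (rule braid_eq.sym) (fact sym.IH)
  next
    case (trans u v w)
    show ?case by (rule braid_eq.trans) (fact trans.IH)+
  next
    case (congruence u v a c)
    then show ?case by (intro braid_eq.congruence words)
  qed (simp_all add: braid_eq.refl braid_eq.cancel_right braid_eq.cancel_left braid_eq.braid
      braid_eq.commute words)
  then show ?thesis unfolding add_strand_def
    by (intro lift_braid_class assms braid_class_eqI) (rule braid_eq.sym)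
qed

lemma word_perm_append: "word_perm (u @ v) = word_perm v \<circ> word_perm u"
  by (induction u) auto

lemma word_perm_cong: "braid_eq m u v \<Longrightarrow> word_perm u = word_perm v"
  by (induction rule: braid_eq.induct)
    (auto simp: word_perm_append fun_eq_iff transpose_def)

lemma braid_perm_class: "w \<in> braid_words m \<Longrightarrow> braid_perm (braid_class m w) = word_perm w"
  unfolding braid_perm_def by (intro lift_braid_class) (auto dest: word_perm_cong)

lemma word_perm_permutes: "w \<in> braid_words m \<Longrightarrow> word_perm w permutes {1..m}"
proof (induction w)
  case (Cons l w)
  then show ?case unfolding word_perm.simps
    by (intro permutes_compose permutes_swap_id) auto
qed (simp add: permutes_id)

lemma word_over_append:
  "word_over (u @ v) i j = word_over u i j + word_over v (word_perm u i) (word_perm u j)"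
  by (induction u arbitrary: i j) auto

lemma word_over_cong: "braid_eq m u v \<Longrightarrow> word_over u i j = word_over v i j"
proof (induction arbitrary: i j rule: braid_eq.induct)
  case (congruence u v a c)
  then show ?case using word_perm_cong by (simp add: word_over_append)
qed (auto simp: transpose_def)

lemma word_crossing_matrix_cong:
  assumes "braid_eq m u v"
  shows "word_crossing_matrix m u = word_crossing_matrix m v"
proof -
  have "word_over u = word_over v"
    by (intro ext word_over_cong[OF assms])
  then show ?thesis by (simp only: word_crossing_matrix_def)
qed

lemma crossing_matrix_class:
  "w \<in> braid_words m \<Longrightarrow> crossing_matrix m (braid_class m w) = word_crossing_matrix m w"
  unfolding crossing_matrix_def
  by (intro lift_braid_class) (auto dest: word_crossing_matrix_cong)

context group
begin

lemma conj_by_closed [simp]: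
  "g \<in> carrier G \<Longrightarrow> h \<in> carrier G \<Longrightarrow> conj_by G g h \<in> carrier G"
  by (simp add: conj_by_def)

lemma hurwitz_letter_length [simp]: "length (hurwitz_letter G gs l) = length gs"
  by (cases l) auto

lemma hurwitz_letter_closed:
  assumes "set gs \<subseteq> carrier G" "letter_index l \<in> {1..<length gs}"
  shows "set (hurwitz_letter G gs l) \<subseteq> carrier G"
proof -
  have "gs ! letter_index l \<in> carrier G" "gs ! (letter_index l - 1) \<in> carrier G"
    using assms nth_mem[of "letter_index l" gs] nth_mem[of "letter_index l - 1" gs] by auto
  with assms show ?thesis
    by (cases l) (simp_all add: set_update_subsetI)
qed

lemma hurwitz_word_closed:
  "w \<in> braid_words n \<Longrightarrow> set gs \<subseteq> carrier G \<Longrightarrow> length gs = n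
    \<Longrightarrow> set (foldl (hurwitz_letter G) gs w) \<subseteq> carrier G
      \<and> length (foldl (hurwitz_letter G) gs w) = n"
proof (induction w arbitrary: gs)
  case (Cons l w)
  then have "set (hurwitz_letter G gs l) \<subseteq> carrier G"
    by (intro hurwitz_letter_closed) auto
  with Cons show ?case by simp
qed simp

lemma hurwitz_simps:
  assumes "a \<in> carrier G" "b \<in> carrier G"
  shows "inv a \<otimes> (a \<otimes> b) = b" "a \<otimes> (inv a \<otimes> b) = b"
  using assms by (simp_all flip: m_assoc)

lemma hurwitz_word_cong:
  "braid_eq n u v \<Longrightarrow> set gs \<subseteq> carrier G \<Longrightarrow> length gs = n
    \<Longrightarrow> foldl (hurwitz_letter G) gs u = foldl (hurwitz_letter G) gs v"
proof (induction arbitrary: gs rule: braid_eq.induct)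
  case (congruence u v a c)
  then show ?case using hurwitz_word_closed by simp
next
  case (cancel_right i)
  then have [simp]: "gs ! i \<in> carrier G" "gs ! (i - Suc 0) \<in> carrier G"
    using nth_mem[of i gs] nth_mem[of "i - Suc 0" gs] by auto
  show ?case using cancel_right
    by (intro nth_equalityI)
      (auto simp: nth_list_update conj_by_def m_assoc hurwitz_simps)
next
  case (cancel_left i)
  then have [simp]: "gs ! i \<in> carrier G" "gs ! (i - Suc 0) \<in> carrier G"
    using nth_mem[of i gs] nth_mem[of "i - Suc 0" gs] by auto
  show ?case using cancel_left
    by (intro nth_equalityI)
      (auto simp: nth_list_update conj_by_def m_assoc hurwitz_simps)
next
  case (braid i)
  then have [simp]: "gs ! i \<in> carrier G" "gs ! (i - Suc 0) \<in> carrier G" "gs ! Suc i \<in> carrier G"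
    using nth_mem[of i gs] nth_mem[of "i - Suc 0" gs] nth_mem[of "Suc i" gs] by auto
  show ?case using braid
    by (intro nth_equalityI)
      (auto simp: nth_list_update conj_by_def m_assoc inv_mult_group hurwitz_simps)
next
  case (commute i j)
  then show ?case
    by (intro nth_equalityI) (auto simp: nth_list_update)
qed auto

lemma hurwitz_act_class:
  assumes "set gs \<subseteq> carrier G" "w \<in> braid_words (length gs)"
  shows "hurwitz_act G gs (braid_class (length gs) w) = foldl (hurwitz_letter G) gs w"
  unfolding hurwitz_act_def
  using assms by (intro lift_braid_class) (auto dest: hurwitz_word_cong)

end

end

theory Submission
  imports Defs
begin

text \<open>
  Each entry \<open>b\<close> of a braid system contributes to the essential eigenvalue set the nontrivial
  eigenvalues of the crossing matrix of \<open>b\<^sup>r\<close>, where \<open>r\<close> is the order of the braid permutation;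
  this contribution is called \<open>essential_part\<close> below. The theorem follows from two properties of
  the contribution.

  It is a conjugacy invariant (\<open>essential_part_conj\<close>). Crossing matrices satisfy the cocycle rule
  \<open>C(uv)(i, j) = C(u)(i, j) + C(v)(u i, u j)\<close>, where \<open>u i\<close> is the bottom position of strand \<open>i\<close>
  of \<open>u\<close>. Since \<open>b\<^sup>r\<close> is pure, in \<open>a\<^sup>-\<^sup>1 b\<^sup>r a\<close> the terms coming from \<open>a\<^sup>-\<^sup>1\<close>
  and from \<open>a\<close> add up to those of the trivial braid \<open>a\<^sup>-\<^sup>1 a\<close> and cancel. What remains is
  \<open>C(b\<^sup>r)\<close> with its rows and columns renumbered by one permutation, which has the same
  characteristic polynomial. Purity is essential: this is the reason for passing from \<open>b\<close> to \<open>b\<^sup>r\<close>.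
  A Hurwitz letter exchanges two entries and conjugates one of them, so both Hurwitz
  actions and global conjugations only permute the contributions.

  It is blind to stabilization. An extra trivial strand does not change \<open>r\<close> and borders the crossing
  matrix with a zero row and column, which adds one eigenvalue \<open>0\<close>. The new entries
  \<open>\<sigma>\<^sub>m\<close> and its inverse have permutation order \<open>2\<close>, and in their squares the last two
  strands pass over each other once each. So the crossing matrix is, up to sign, that of a
  transposition of two coordinates, extended by zero, and its eigenvalues lie in \<open>{0, 1, -1}\<close>: the
  values discarded in the definition.
\<close>

section \<open>Characteristic polynomials\<close>

lemma char_poly_nonzero:
  fixes A :: "'a :: comm_ring_1 mat"
  assumes "A \<in> carrier_mat n n"
  shows "char_poly A \<noteq> 0"
proof
  assume "char_poly A = 0"
  with degree_monic_char_poly[OF assms] show False by simp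
qed

text \<open>Permuting the rows and then the columns by the same permutation multiplies the determinant
  twice by the same sign; the diagonal part \<open>x I\<close> of \<open>x I - A\<close> is unaffected because the
  two permutations agree.\<close>

lemma char_poly_permute:
  fixes A :: "'a :: comm_ring_1 mat"
  assumes A: "A \<in> carrier_mat n n" and p: "p permutes {0..<n}"
  shows "char_poly (mat n n (\<lambda>(i, j). A $$ (p i, p j))) = char_poly A"
proof -
  let ?M = "char_poly_matrix A"
  let ?R = "mat n n (\<lambda>(i, j). ?M $$ (p i, j))"
  have M: "?M \<in> carrier_mat n n" using A by simp
  have p_lt: "p i < n" if "i < n" for i
    using permutes_in_image[OF p, of i] that by simp
  have p_inj: "p i = p j \<longleftrightarrow> i = j" for i j
    using permutes_inj[OF p] by (auto dest: injD)
  have "char_poly_matrix (mat n n (\<lambda>(i, j). A $$ (p i, p j)))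
      = transpose_mat (mat n n (\<lambda>(i, j). transpose_mat ?R $$ (p i, j)))"
    using A by (intro eq_matI) (auto simp: char_poly_matrix_def p_lt p_inj)
  then have "char_poly (mat n n (\<lambda>(i, j). A $$ (p i, p j)))
      = det (transpose_mat (mat n n (\<lambda>(i, j). transpose_mat ?R $$ (p i, j))))"
    by (simp add: char_poly_def)
  also have "\<dots> = det (mat n n (\<lambda>(i, j). transpose_mat ?R $$ (p i, j)))"
    by (rule det_transpose[where n = n]) simp
  also have "\<dots> = signof p * det (transpose_mat ?R)"
    by (rule det_permute_rows[OF _ p]) simp
  also have "det (transpose_mat ?R) = det ?R"
    by (rule det_transpose[where n = n]) simp
  also have "det ?R = signof p * det ?M"
    by (rule det_permute_rows[OF M p])
  also have "signof p * (signof p * det ?M) = char_poly A"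
    by (simp add: char_poly_def sign_def)
  finally show ?thesis .
qed

lemma char_poly_block_diagonal:
  fixes A D :: "'a :: idom mat"
  assumes A: "A \<in> carrier_mat n n" and D: "D \<in> carrier_mat k k"
  shows "char_poly (four_block_mat A (0\<^sub>m n k) (0\<^sub>m k n) D) = char_poly A * char_poly D"
proof -
  have "char_poly_matrix (four_block_mat A (0\<^sub>m n k) (0\<^sub>m k n) D)
      = four_block_mat (char_poly_matrix A) (0\<^sub>m n k) (0\<^sub>m k n) (char_poly_matrix D)"
    using A D by (intro eq_matI) (auto simp: char_poly_matrix_def)
  then show ?thesis
    using A D unfolding char_poly_def
    by (simp add: det_four_block_mat_upper_right_zero[where n = n and m = k])
qed

lemma char_poly_zero_mat:
  "char_poly (0\<^sub>m n n :: 'a :: comm_ring_1 mat) = [:0, 1:] ^ n"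
proof -
  have "char_poly (0\<^sub>m n n :: 'a mat) = (\<Prod>a\<leftarrow>diag_mat (0\<^sub>m n n :: 'a mat). [:- a, 1:])"
    by (rule char_poly_upper_triangular) auto
  also have "diag_mat (0\<^sub>m n n :: 'a mat) = replicate n 0"
    by (auto simp: diag_mat_def intro: nth_equalityI)
  finally show ?thesis by simp
qed

lemma char_poly_antidiagonal:
  fixes c :: "'a :: idom"
  shows "char_poly (mat 2 2 (\<lambda>(i, j). if i = j then 0 else c)) = [:- c, 1:] * [:c, 1:]"
proof -
  have "char_poly_matrix (mat 2 2 (\<lambda>(i, j). if i = j then 0 else c))
     = four_block_mat (mat 1 1 (\<lambda>_. [:0, 1:])) (mat 1 1 (\<lambda>_. [:- c:]))
         (mat 1 1 (\<lambda>_. [:- c:])) (mat 1 1 (\<lambda>_. [:0, 1:]))"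
    by (intro eq_matI) (auto simp: char_poly_matrix_def)
  moreover have "det \<dots> = det (mat 1 1 (\<lambda>_. [:0, 1:]) * mat 1 1 (\<lambda>_. [:0, 1:])
      - mat 1 1 (\<lambda>_. [:- c:]) * mat 1 1 (\<lambda>_. [:- c:]) :: 'a poly mat)"
    by (rule det_four_block_mat[where n = 1]) (auto intro!: eq_matI simp: scalar_prod_def)
  moreover have "\<dots> = [:- c, 1:] * [:c, 1:]"
    by (subst det_single) (auto simp: scalar_prod_def)
  ultimately show ?thesis by (simp add: char_poly_def)
qed

section \<open>Powers and orders of braids\<close>

lemma braid_class_pow:
  assumes "w \<in> braid_words m"
  shows "concat (replicate n w) \<in> braid_words m"
    and "braid_class m w [^]\<^bsub>braid_group m\<^esub> n = braid_class m (concat (replicate n w))"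
proof -
  show closed: "concat (replicate n w) \<in> braid_words m" for n
    using assms by (induction n) auto
  have comm: "concat (replicate n w) @ w = w @ concat (replicate n w)" for n
    by (induction n) auto
  show "braid_class m w [^]\<^bsub>braid_group m\<^esub> n = braid_class m (concat (replicate n w))"
    using assms closed
    by (induction n) (simp_all add: nat_pow_def braid_one braid_mult comm)
qed

lemma braid_words_Suc: "w \<in> braid_words m \<Longrightarrow> w \<in> braid_words (Suc m)"
  by (induction w) auto

lemma add_strand_pow:
  assumes "b \<in> carrier (braid_group m)"
  shows "add_strand m b [^]\<^bsub>braid_group (Suc m)\<^esub> (n :: nat)
    = add_strand m (b [^]\<^bsub>braid_group m\<^esub> n)"
proof -
  obtain w where w: "w \<in> braid_words m" "b = braid_class m w"
    using assms by (rule braid_cases)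
  moreover note braid_words_Suc[OF w(1)]
  ultimately show ?thesis
    by (simp add: braid_class_pow add_strand_class)
qed

text \<open>Words are read from left to right but maps are composed from right to left, hence the
  reversal.\<close>

lemma braid_perm_mult:
  assumes "b \<in> carrier (braid_group m)" "c \<in> carrier (braid_group m)"
  shows "braid_perm (b \<otimes>\<^bsub>braid_group m\<^esub> c) = braid_perm c \<circ> braid_perm b"
proof -
  obtain u v where "u \<in> braid_words m" "b = braid_class m u"
    "v \<in> braid_words m" "c = braid_class m v"
    using assms by (metis braid_cases)
  then show ?thesis
    by (simp add: braid_mult braid_perm_class word_perm_append)
qed

lemma braid_perm_one: "braid_perm \<one>\<^bsub>braid_group m\<^esub> = id"
  by (simp add: braid_one braid_perm_class)

lemma braid_perm_permutes:
  "b \<in> carrier (braid_group m) \<Longrightarrow> braid_perm b permutes {1..m}"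
  by (metis braid_cases braid_perm_class word_perm_permutes)

lemma braid_perm_pow:
  assumes "b \<in> carrier (braid_group m)"
  shows "braid_perm (b [^]\<^bsub>braid_group m\<^esub> n) = braid_perm b ^^ n"
proof -
  interpret group "braid_group m" by (rule group_braid_group)
  show ?thesis
    using assms by (induction n) (simp_all add: braid_perm_one braid_perm_mult)
qed

lemma braid_perm_add_strand:
  assumes "b \<in> carrier (braid_group m)"
  shows "braid_perm (add_strand m b) = braid_perm b"
proof -
  obtain w where w: "w \<in> braid_words m" "b = braid_class m w"
    using assms by (rule braid_cases)
  moreover note braid_words_Suc[OF w(1)]
  ultimately show ?thesis
    by (simp add: add_strand_class braid_perm_class)
qed

lemma add_strand_closed:
  assumes "b \<in> carrier (braid_group m)"
  shows "add_strand m b \<in> carrier (braid_group (Suc m))"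
proof -
  obtain w where w: "w \<in> braid_words m" "b = braid_class m w"
    using assms by (rule braid_cases)
  moreover note braid_words_Suc[OF w(1)]
  ultimately show ?thesis
    by (simp add: add_strand_class braid_class_closed)
qed

lemma perm_order_dvd_iff:
  assumes "b \<in> carrier (braid_group m)"
  shows "perm_order m b dvd n \<longleftrightarrow> braid_perm b ^^ n = id"
proof -
  interpret group "sym_group m" by (rule sym_group_is_group)
  have pow: "p [^]\<^bsub>sym_group m\<^esub> k = p ^^ k" for p and k :: nat
    by (induction k) (simp_all add: sym_group_one sym_group_mult funpow_Suc_right del: funpow.simps)
  have "braid_perm b \<in> carrier (sym_group m)"
    using braid_perm_permutes[OF assms] by (simp add: sym_group_carrier)
  from pow_eq_id[OF this, of n] show ?thesis
    by (simp add: perm_order_def pow sym_group_one)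
qed

text \<open>The two braids may have different degrees: the order depends on the permutation only as
  a function, not on the symmetric group containing it.\<close>

lemma perm_order_eqI:
  assumes "b \<in> carrier (braid_group m)" "c \<in> carrier (braid_group k)"
    and "\<And>n. braid_perm b ^^ n = id \<longleftrightarrow> braid_perm c ^^ n = id"
  shows "perm_order m b = perm_order k c"
proof -
  have "perm_order m b dvd n \<longleftrightarrow> perm_order k c dvd n" for n
    by (simp add: assms perm_order_dvd_iff)
  then show ?thesis by (metis dvd_antisym dvd_refl)
qed

definition essential_part :: "nat \<Rightarrow> braid \<Rightarrow> complex multiset" where
  "essential_part m b = filter_mset (\<lambda>x. x \<notin> {0, 1, - 1})
    (eigenvalues_mset (crossing_matrix m (b [^]\<^bsub>braid_group m\<^esub> perm_order m b)))"

lemma essential_eigenvalues_sum: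
  "essential_eigenvalues (m, bs) = (\<Sum>b\<leftarrow>bs. essential_part m b)"
  unfolding essential_eigenvalues_def
  by (induction bs) (simp_all add: essential_part_def)

section \<open>Conjugation\<close>

lemma (in group) conj_by_pow:
  assumes "g \<in> carrier G" "h \<in> carrier G"
  shows "conj_by G g h [^] (n :: nat) = conj_by G (g [^] n) h"
  using assms
proof (induction n)
  case (Suc n)
  have "h \<otimes> (inv h \<otimes> x) = x" if "x \<in> carrier G" for x
    using that Suc.prems by (simp flip: m_assoc)
  with Suc show ?case by (simp add: conj_by_def m_assoc)
qed (simp add: conj_by_def)

lemma braid_perm_inv:
  assumes "a \<in> carrier (braid_group m)"
  shows "braid_perm a \<circ> braid_perm (inv\<^bsub>braid_group m\<^esub> a) = id"
    and "braid_perm (inv\<^bsub>braid_group m\<^esub> a) \<circ> braid_perm a = id"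
proof -
  interpret group "braid_group m" by (rule group_braid_group)
  show "braid_perm a \<circ> braid_perm (inv\<^bsub>braid_group m\<^esub> a) = id"
    "braid_perm (inv\<^bsub>braid_group m\<^esub> a) \<circ> braid_perm a = id"
    using assms by (simp_all add: braid_perm_one flip: braid_perm_mult[of _ m])
qed

lemma braid_perm_conj_eq_id_iff:
  assumes "b \<in> carrier (braid_group m)" "a \<in> carrier (braid_group m)"
  shows "braid_perm (conj_by (braid_group m) b a) = id \<longleftrightarrow> braid_perm b = id"
proof -
  interpret group "braid_group m" by (rule group_braid_group)
  let ?p = "braid_perm a" and ?q = "braid_perm (inv\<^bsub>braid_group m\<^esub> a)"
  have "braid_perm (conj_by (braid_group m) b a) = ?p \<circ> (braid_perm b \<circ> ?q)"
    using assms by (simp add: conj_by_def braid_perm_mult)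
  moreover have "braid_perm b = ?q \<circ> (?p \<circ> (braid_perm b \<circ> ?q)) \<circ> ?p"
    using braid_perm_inv(2)[OF assms(2)] by (simp add: fun_eq_iff)
  ultimately show ?thesis
    using braid_perm_inv[OF assms(2)] by (metis comp_id id_comp)
qed

lemma perm_order_conj:
  assumes "b \<in> carrier (braid_group m)" "a \<in> carrier (braid_group m)"
  shows "perm_order m (conj_by (braid_group m) b a) = perm_order m b"
proof -
  interpret group "braid_group m" by (rule group_braid_group)
  show ?thesis
  proof (rule perm_order_eqI)
    show "braid_perm (conj_by (braid_group m) b a) ^^ n = id \<longleftrightarrow> braid_perm b ^^ n = id" for n
      using assms
      by (simp add: conj_by_pow braid_perm_conj_eq_id_iff flip: braid_perm_pow[of _ m])
  qed (use assms in auto)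
qed

text \<open>Take words \<open>u\<close>, \<open>w\<close>, \<open>v\<close> for \<open>a\<^sup>-\<^sup>1\<close>, \<open>p\<close>, \<open>a\<close>. Because \<open>p\<close> is pure, the strands enter the
  part \<open>v\<close> of \<open>uwv\<close> at the same positions as in \<open>uv\<close>. There the crossings counted in \<open>u\<close> and \<open>v\<close>
  cancel, since \<open>uv\<close> represents the trivial braid. The crossings in \<open>w\<close> remain, renumbered by
  the permutation of \<open>u\<close>.\<close>

lemma crossing_matrix_conj_pure:
  assumes p: "p \<in> carrier (braid_group m)" "braid_perm p = id"
    and a: "a \<in> carrier (braid_group m)"
  obtains \<pi> where "\<pi> permutes {0..<m}"
    "crossing_matrix m (conj_by (braid_group m) p a)
      = mat m m (\<lambda>(i, j). crossing_matrix m p $$ (\<pi> i, \<pi> j))"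
proof -
  interpret group "braid_group m" by (rule group_braid_group)
  obtain u v w where words: "u \<in> braid_words m" "inv\<^bsub>braid_group m\<^esub> a = braid_class m u"
    "v \<in> braid_words m" "a = braid_class m v" "w \<in> braid_words m" "p = braid_class m w"
    using p a by (metis braid_cases inv_closed)
  have conj: "conj_by (braid_group m) p a = braid_class m (u @ w @ v)"
    using words by (simp add: conj_by_def braid_mult)
  have "braid_class m (u @ v) = braid_class m []"
    using words a l_inv[OF a] by (simp add: braid_mult braid_one)
  then have "braid_eq m (u @ v) []"
    using words by (subst (asm) braid_class_eq_iff) auto
  then have cancel: "word_over u i j + word_over v (word_perm u i) (word_perm u j) = 0" for i j
    using word_over_cong[of m "u @ v" "[]" i j] by (simp add: word_over_append)
  have pure: "word_perm w = id"
    using p words by (simp add: braid_perm_class)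
  have over: "word_over (u @ w @ v) i j = word_over w (word_perm u i) (word_perm u j)" for i j
    using cancel[of i j] pure by (simp add: word_over_append)
  have perm: "word_perm u permutes {1..m}"
    using words(1) by (rule word_perm_permutes)
  (* Strand numbers start at 1 and matrix indices at 0. *)
  let ?\<pi> = "\<lambda>i. word_perm u (Suc i) - 1"
  have range: "1 \<le> word_perm u (Suc i)" "word_perm u (Suc i) \<le> m \<longleftrightarrow> i < m" for i
    using permutes_in_image[OF perm, of "Suc i"] permutes_not_in[OF perm, of "Suc i"]
    by (auto simp: Suc_le_eq)
  have Suc_\<pi>: "Suc (?\<pi> i) = word_perm u (Suc i)" for i
    using range(1)[of i] by simp
  have inj: "inj ?\<pi>"
  proof (rule injI)
    fix i j assume "?\<pi> i = ?\<pi> j"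
    then have "word_perm u (Suc i) = word_perm u (Suc j)"
      by (metis Suc_\<pi>)
    then show "i = j"
      using permutes_inj[OF perm] by (auto dest: injD)
  qed
  have \<pi>_lt: "?\<pi> i < m \<longleftrightarrow> i < m" for i
    using range[of i] by (auto simp: Suc_le_eq)
  have \<pi>: "?\<pi> permutes {0..<m}"
  proof (rule bij_imp_permutes)
    have "inj_on ?\<pi> {0..<m}"
      by (rule inj_on_subset[OF inj subset_UNIV])
    moreover have "?\<pi> ` {0..<m} \<subseteq> {0..<m}"
    proof (rule image_subsetI)
      fix i assume "i \<in> {0..<m}"
      then show "?\<pi> i \<in> {0..<m}"
        unfolding atLeast0LessThan lessThan_iff \<pi>_lt .
    qed
    ultimately show "bij_betw ?\<pi> {0..<m} {0..<m}"
      unfolding bij_betw_def by (intro conjI endo_inj_surj) auto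
    show "?\<pi> i = i" if "i \<notin> {0..<m}" for i
      using permutes_not_in[OF perm, of "Suc i"] that by simp
  qed
  have matrices:
    "crossing_matrix m (conj_by (braid_group m) p a) = word_crossing_matrix m (u @ w @ v)"
    "crossing_matrix m p = word_crossing_matrix m w"
    unfolding conj using words by (simp_all add: crossing_matrix_class)
  have "crossing_matrix m (conj_by (braid_group m) p a)
      = mat m m (\<lambda>(i, j). crossing_matrix m p $$ (?\<pi> i, ?\<pi> j))"
  proof (rule eq_matI)
    fix i j
    assume "i < dim_row (mat m m (\<lambda>(i, j). crossing_matrix m p $$ (?\<pi> i, ?\<pi> j)))"
      "j < dim_col (mat m m (\<lambda>(i, j). crossing_matrix m p $$ (?\<pi> i, ?\<pi> j)))"
    then have ij: "i < m" "j < m" by auto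
    have lt: "?\<pi> i < m" "?\<pi> j < m" using ij \<pi>_lt by blast+
    have eq: "?\<pi> i = ?\<pi> j \<longleftrightarrow> i = j" using inj by (auto dest: injD)
    show "crossing_matrix m (conj_by (braid_group m) p a) $$ (i, j)
        = mat m m (\<lambda>(i, j). crossing_matrix m p $$ (?\<pi> i, ?\<pi> j)) $$ (i, j)"
      unfolding index_mat(1)[OF ij] prod.case
      unfolding matrices word_crossing_matrix_def index_mat(1)[OF ij] index_mat(1)[OF lt] prod.case
        over Suc_\<pi> eq ..
  qed (simp_all add: matrices word_crossing_matrix_def)
  with \<pi> show thesis by (rule that)
qed

lemma crossing_matrix_carrier:
  "b \<in> carrier (braid_group m) \<Longrightarrow> crossing_matrix m b \<in> carrier_mat m m"
  by (elim braid_cases) (simp add: crossing_matrix_class word_crossing_matrix_def)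

lemma essential_part_conj:
  assumes "b \<in> carrier (braid_group m)" "a \<in> carrier (braid_group m)"
  shows "essential_part m (conj_by (braid_group m) b a) = essential_part m b"
proof -
  interpret group "braid_group m" by (rule group_braid_group)
  define p where "p = b [^]\<^bsub>braid_group m\<^esub> perm_order m b"
  have p: "p \<in> carrier (braid_group m)" "braid_perm p = id"
    using assms perm_order_dvd_iff[OF assms(1), of "perm_order m b"]
    by (simp_all add: p_def braid_perm_pow)
  obtain \<pi> where \<pi>: "\<pi> permutes {0..<m}"
    "crossing_matrix m (conj_by (braid_group m) p a)
      = mat m m (\<lambda>(i, j). crossing_matrix m p $$ (\<pi> i, \<pi> j))"
    using crossing_matrix_conj_pure[OF p assms(2)] .
  let ?C = "map_mat complex_of_int (crossing_matrix m p)"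
  have C: "?C \<in> carrier_mat m m"
    using crossing_matrix_carrier[OF p(1)] by simp
  have "\<pi> i < m" if "i < m" for i
    using permutes_in_image[OF \<pi>(1), of i] that by simp
  then have "map_mat complex_of_int (crossing_matrix m (conj_by (braid_group m) p a))
      = mat m m (\<lambda>(i, j). ?C $$ (\<pi> i, \<pi> j))"
    using C unfolding \<pi>(2) by (intro eq_matI) auto
  with char_poly_permute[OF C \<pi>(1)] show ?thesis
    by (simp add: essential_part_def perm_order_conj[OF assms] conj_by_pow[OF assms]
        eigenvalues_mset_def flip: p_def)
qed

section \<open>Hurwitz moves\<close>

text \<open>Up to conjugation, a Hurwitz letter merely swaps two neighbouring entries.\<close>

lemma (in group) mset_map_hurwitz_letter:
  assumes "set gs \<subseteq> carrier G" "letter_index l \<in> {1..<length gs}"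
    and f: "\<And>g h. g \<in> carrier G \<Longrightarrow> h \<in> carrier G \<Longrightarrow> f (conj_by G g h) = f g"
  shows "mset (map f (hurwitz_letter G gs l)) = mset (map f gs)"
proof -
  let ?i = "letter_index l"
  have "gs ! ?i \<in> carrier G" "gs ! (?i - 1) \<in> carrier G"
    using assms nth_mem[of ?i gs] nth_mem[of "?i - 1" gs] by auto
  then have "map f (hurwitz_letter G gs l)
      = (map f gs)[?i - 1 := map f gs ! ?i, ?i := map f gs ! (?i - 1)]"
    using assms by (cases l) (auto simp: map_update)
  then show ?thesis
    using assms(2) mset_swap[of ?i "map f gs" "?i - 1"] by (auto simp del: nth_map)
qed

lemma (in group) mset_map_hurwitz_word:
  assumes "w \<in> braid_words (length gs)" "set gs \<subseteq> carrier G"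
    and f: "\<And>g h. g \<in> carrier G \<Longrightarrow> h \<in> carrier G \<Longrightarrow> f (conj_by G g h) = f g"
  shows "mset (map f (foldl (hurwitz_letter G) gs w)) = mset (map f gs)"
  using assms(1,2)
proof (induction w arbitrary: gs)
  case (Cons l w)
  then have l: "letter_index l \<in> {1..<length gs}" by simp
  have "mset (map f (foldl (hurwitz_letter G) (hurwitz_letter G gs l) w))
      = mset (map f (hurwitz_letter G gs l))"
    using Cons.prems by (intro Cons.IH hurwitz_letter_closed) auto
  also have "\<dots> = mset (map f gs)"
    by (rule mset_map_hurwitz_letter[OF Cons.prems(2) l f])
  finally show ?case by simp
qed simp

section \<open>Stabilization\<close>

lemma word_over_last_strand:
  assumes "w \<in> braid_words m"
  shows "word_over w (Suc m) j = 0" "word_over w j (Suc m) = 0"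
proof -
  have "word_over w (Suc m) j = 0 \<and> word_over w j (Suc m) = 0"
    using assms
  proof (induction w arbitrary: j)
    case (Cons l w)
    then show ?case by (cases l) (auto simp: transpose_def)
  qed simp
  then show "word_over w (Suc m) j = 0" "word_over w j (Suc m) = 0" by auto
qed

lemma crossing_matrix_add_strand:
  assumes "b \<in> carrier (braid_group m)"
  shows "crossing_matrix (Suc m) (add_strand m b)
    = four_block_mat (crossing_matrix m b) (0\<^sub>m m 1) (0\<^sub>m 1 m) (0\<^sub>m 1 1)"
proof -
  obtain w where w: "w \<in> braid_words m" "b = braid_class m w"
    using assms by (rule braid_cases)
  moreover note braid_words_Suc[OF w(1)]
  ultimately show ?thesis
    by (intro eq_matI)
      (auto simp: add_strand_class crossing_matrix_class word_crossing_matrix_def less_Suc_eq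
        word_over_last_strand[OF w(1)])
qed

lemma essential_part_add_strand:
  assumes b: "b \<in> carrier (braid_group m)"
  shows "essential_part (Suc m) (add_strand m b) = essential_part m b"
proof -
  interpret group "braid_group m" by (rule group_braid_group)
  have order: "perm_order (Suc m) (add_strand m b) = perm_order m b"
    by (rule perm_order_eqI[OF add_strand_closed[OF b] b]) (simp add: braid_perm_add_strand[OF b])
  define p where "p = b [^]\<^bsub>braid_group m\<^esub> perm_order m b"
  have p: "p \<in> carrier (braid_group m)" using b by (simp add: p_def)
  let ?C = "map_mat complex_of_int (crossing_matrix m p)"
  have C: "?C \<in> carrier_mat m m"
    using crossing_matrix_carrier[OF p] by simp
  have "map_mat complex_of_int (crossing_matrix (Suc m) (add_strand m p))
      = four_block_mat ?C (0\<^sub>m m 1) (0\<^sub>m 1 m) (0\<^sub>m 1 1)"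
    using C unfolding crossing_matrix_add_strand[OF p] by (intro eq_matI) auto
  then have "char_poly (map_mat complex_of_int (crossing_matrix (Suc m) (add_strand m p)))
      = char_poly ?C * [:0, 1:]"
    using char_poly_block_diagonal[OF C, of "0\<^sub>m 1 1" 1] char_poly_zero_mat[of 1, where 'a = complex]
    by simp
  then have "eigenvalues_mset (crossing_matrix (Suc m) (add_strand m p))
      = eigenvalues_mset (crossing_matrix m p) + {#0#}"
    using char_poly_nonzero[OF C] by (simp add: eigenvalues_mset_def proots_mult del: mult_pCons_right)
  then show ?thesis
    by (simp add: essential_part_def order add_strand_pow[OF b] flip: p_def)
qed

text \<open>The square of a generator or of its inverse is a full twist of the last two strands, with
  one crossing of sign \<open>c\<close> at which each of them passes over the other. The eigenvalues are
  \<open>c\<close>, \<open>- c\<close> and zeros.\<close>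

lemma essential_part_last_generator:
  assumes m: "1 \<le> m" and l: "letter_index l = m"
  shows "essential_part (Suc m) (braid_class (Suc m) [l]) = {#}"
proof -
  define c :: int where "c = (case l of Sig _ \<Rightarrow> 1 | SigInv _ \<Rightarrow> - 1)"
  have words: "[l] \<in> braid_words (Suc m)" "[l, l] \<in> braid_words (Suc m)"
    using m l by auto
  let ?b = "braid_class (Suc m) [l]"
  have b: "?b \<in> carrier (braid_group (Suc m))"
    using words(1) by (rule braid_class_closed)
  have perm: "braid_perm ?b = transpose m (Suc m)"
    using words l by (simp add: braid_perm_class)
  (* The permutation is a transposition, so its order divides 2 but is not 1. *)
  have "perm_order (Suc m) ?b dvd 2"
    unfolding perm_order_dvd_iff[OF b] by (simp add: perm numeral_2_eq_2)
  moreover have "\<not> perm_order (Suc m) ?b dvd 1"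
    unfolding perm_order_dvd_iff[OF b]
    by (auto simp: perm fun_eq_iff intro!: exI[of _ m])
  ultimately have order: "perm_order (Suc m) ?b = 2"
    by (metis dvd_refl prime_nat_iff two_is_prime_nat)
  have over: "word_over [l, l] i j
      = (if i \<noteq> j \<and> i \<in> {m, Suc m} \<and> j \<in> {m, Suc m} then c else 0)" for i j
    using l by (cases l) (auto simp: c_def transpose_def)
  have "?b [^]\<^bsub>braid_group (Suc m)\<^esub> (2 :: nat) = braid_class (Suc m) [l, l]"
    unfolding braid_class_pow(2)[OF words(1)] by (simp add: numeral_2_eq_2)
  then have "crossing_matrix (Suc m) (?b [^]\<^bsub>braid_group (Suc m)\<^esub> perm_order (Suc m) ?b)
      = word_crossing_matrix (Suc m) [l, l]"
    using words by (simp only: order crossing_matrix_class)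
  moreover have "map_mat complex_of_int (word_crossing_matrix (Suc m) [l, l])
      = four_block_mat (0\<^sub>m (m - 1) (m - 1)) (0\<^sub>m (m - 1) 2) (0\<^sub>m 2 (m - 1))
          (mat 2 2 (\<lambda>(i, j). if i = j then 0 else of_int c))" (is "_ = ?F")
  proof (rule eq_matI)
    fix i j assume "i < dim_row ?F" "j < dim_col ?F"
    then have ij: "i < Suc m" "j < Suc m" using m by auto
    then consider "i < m - 1 \<or> j < m - 1" | "i \<in> {m - 1, m}" "j \<in> {m - 1, m}"
      by force
    then show "map_mat complex_of_int (word_crossing_matrix (Suc m) [l, l]) $$ (i, j) = ?F $$ (i, j)"
    proof cases
      case 1
      then have "\<not> (i \<in> {m - 1, m} \<and> j \<in> {m - 1, m})" by auto
      with 1 ij m show ?thesis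
        by (auto simp: word_crossing_matrix_def over simp del: word_over.simps)
    next
      case 2
      with m show ?thesis
        by (auto simp: word_crossing_matrix_def over simp del: word_over.simps)
    qed
  qed (use m in \<open>auto simp: word_crossing_matrix_def\<close>)
  moreover have "char_poly ?F = [:0, 1:] ^ (m - 1) * ([:- of_int c, 1:] * [:of_int c, 1:])"
    by (subst char_poly_block_diagonal)
      (simp_all add: char_poly_zero_mat char_poly_antidiagonal
        del: mult_pCons_right mult_pCons_left)
  ultimately have "eigenvalues_mset
      (crossing_matrix (Suc m) (?b [^]\<^bsub>braid_group (Suc m)\<^esub> perm_order (Suc m) ?b))
      = repeat_mset (m - 1) {#0#} + {#of_int c, - of_int c#}"
    by (simp add: eigenvalues_mset_def proots_mult proots_power
        del: mult_pCons_right mult_pCons_left)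
  then show ?thesis
    by (cases l) (auto simp: essential_part_def c_def filter_mset_eq_conv filter_empty_mset)
qed

lemma inv_last_generator:
  assumes "1 \<le> m"
  shows "inv\<^bsub>braid_group (Suc m)\<^esub> (sigma (Suc m) m) = braid_class (Suc m) [SigInv m]"
proof -
  interpret group "braid_group (Suc m)" by (rule group_braid_group)
  have words: "[Sig m] \<in> braid_words (Suc m)" "[SigInv m] \<in> braid_words (Suc m)"
    using assms by auto
  have "braid_eq (Suc m) [SigInv m, Sig m] []"
    using assms by (intro braid_eq.cancel_left) simp
  then show ?thesis
    using words
    by (intro inv_equality)
      (auto simp: sigma_def braid_mult braid_one braid_class_closed dest: braid_class_eqI)
qed

lemma essential_eigenvalues_stabilize:
  assumes "is_braid_system S"
  shows "essential_eigenvalues (stabilize S) = essential_eigenvalues S"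
proof -
  obtain m bs where S: "S = (m, bs)" by (cases S)
  with assms have m: "1 \<le> m" and bs: "set bs \<subseteq> carrier (braid_group m)"
    by (auto simp: is_braid_system_def)
  have "map (essential_part (Suc m)) (map (add_strand m) bs) = map (essential_part m) bs"
    using bs by (auto simp: essential_part_add_strand)
  then show ?thesis
    using essential_part_last_generator[OF m, of "Sig m"]
      essential_part_last_generator[OF m, of "SigInv m"]
    by (simp add: S stabilize_def essential_eigenvalues_sum sigma_def
        inv_last_generator[OF m, unfolded sigma_def]
        del: map_map)
qed

lemma essential_eigenvalues_move:
  assumes "braid_move S S'"
  shows "essential_eigenvalues S = essential_eigenvalues S'"
  using assms
proof cases
  case (hurwitz m bs \<beta>)
  interpret group "braid_group m" by (rule group_braid_group)
  have bs: "set bs \<subseteq> carrier (braid_group m)"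
    using hurwitz by (simp add: is_braid_system_def)
  obtain w where w: "w \<in> braid_words (length bs)" "\<beta> = braid_class (length bs) w"
    using hurwitz by (metis braid_cases)
  have "mset (map (essential_part m) (hurwitz_act (braid_group m) bs \<beta>))
      = mset (map (essential_part m) bs)"
    unfolding w(2) hurwitz_act_class[OF bs w(1)]
    by (rule mset_map_hurwitz_word[where f = "essential_part m", OF w(1) bs essential_part_conj])
  then show ?thesis
    unfolding hurwitz essential_eigenvalues_sum by (metis sum_mset_sum_list)
next
  case (conjugation m bs a)
  have "map (essential_part m) (map (\<lambda>b. conj_by (braid_group m) b a) bs)
      = map (essential_part m) bs"
    using conjugation by (auto simp: is_braid_system_def essential_part_conj)
  then show ?thesis
    unfolding conjugation by (simp only: essential_eigenvalues_sum)
qed (simp_all add: essential_eigenvalues_stabilize)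

theorem theorem2:
  fixes S S' :: braid_system
  assumes "is_braid_system S" and "is_braid_system S'"
    and "braid_move\<^sup>*\<^sup>* S S'"
  shows "essential_eigenvalues S = essential_eigenvalues S'"
  using assms(3) by (induction rule: rtranclp_induct) (simp_all add: essential_eigenvalues_move)

end
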